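(* Let $\alpha:\mathsf{CFES}\to\mathsf{iPreDSC}$ be given by $\alpha(E,\mathrm{en})=(E,\mathrm{en}_0)$ and $\beta:\mathsf{iPreDSC}\to\mathsf{CFES}$ by $\beta(E,\mathrm{dep})=(E,\mathrm{en}_{\mathrm{dep}})$, where $\mathrm{en}_{\mathrm{dep}}(e)=\{X\subseteq E:\exists Y\subseteq X,\ Y\in\mathrm{dep}(e)\}$, both acting as the identity on underlying functions of morphisms. Then $\alpha$ and $\beta$ define an isomorphism of categories $\mathsf{CFES}\cong\mathsf{iPreDSC}$, such that, as functors to the category $\mathsf{FinPos}$ of finite posets and order-preserving maps, $\mathsf{rdp}\circ\alpha^{op}=\mathcal F$ and $\mathcal F\circ\beta^{op}=\mathsf{rdp}$ (strict equality).
   Context: $P(A)$ denotes the power set of $A$. PreDSCs. A preDSC is a pair $(E,\mathrm{dep})$ with $E$ a finite set and $\mathrm{dep}:E\to P(P(E))$ a function. For $X,Y\subseteq E$ write $X\,\mathrm{rch}\,Y$ if $X\subseteq Y$ and for every $y\in Y$ there is $D\in\mathrm{dep}(y)$ with $D\subseteq X$. A subset $X\subseteq E$ is reachable if there is a finite sequence of subsets with $\varnothing\,\mathrm{rch}\,X_0\,\mathrm{rch}\cdots\mathrm{rch}\,X_n\,\mathrm{rch}\,X$. A morphism of preDSCs is a function $f:E\to E'$ such that $f^{-1}(X)$ is reachable for every reachable $X\subseteq E'$. A preDSC is irredundant if $D_0,D_1\in\mathrm{dep}(e)$, $D_0\subseteq D_1$ imply $D_0=D_1$. $\mathsf{iPreDSC}$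 is the category of irredundant preDSCs and morphisms of preDSCs. $\mathsf{rdp}(E)$ is the poset of reachable subsets of $E$ ordered by inclusion; it is a contravariant functor via $\mathsf{rdp}(f)=f^{-1}$. Event structures. A conflict-free event structure (CFES) is a pair $(E,\mathrm{en})$ with $E$ a finite set and $\mathrm{en}:E\to P(P(E))$ such that $X\in\mathrm{en}(e)$ and $X\subseteq Y\subseteq E$ imply $Y\in\mathrm{en}(e)$. A configuration is a subset $X\subseteq E$ such that for every $e\in X$ there is a finite sequence $e_0,\dots,e_n\in X$ with $e_n=e$ and $\{e_0,\dots,e_{i-1}\}\in\mathrm{en}(e_i)$ for all $0\le i\le n$ (for $i=0$ this set is empty). A morphism of CFESs is a function $f:E\to E'$ such that $f^{-1}(X)$ is a configuration of $E$ for every configuration $X\subseteq E'$; $\mathsf{CFES}$ is the resulting category. $\mathcal F(E)$ is the poset of configurations ordered by inclusion, a contravariant functor via $\mathcal F(f)=f^{-1}$. $X\in\mathrm{en}_0(e)$ means $X\in\mathrm{en}(e)$ and $Y\subseteq X$, $Y\in\mathrm{en}(e)$ imply $Y=X$. *)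

theory Defs
  imports "HOL-Library.FuncSet"
begin

section \<open>Categories and functors\<close>

record ('o, 'm) cat =
  Ob :: "'o set"
  Arr :: "'m set"
  Dom :: "'m \<Rightarrow> 'o"
  Cod :: "'m \<Rightarrow> 'o"
  Id :: "'o \<Rightarrow> 'm"
  Comp :: "'m \<Rightarrow> 'm \<Rightarrow> 'm"

locale category =
  fixes C :: "('o, 'm) cat"
  assumes Dom_in: "f \<in> Arr C \<Longrightarrow> Dom C f \<in> Ob C"
    and Cod_in: "f \<in> Arr C \<Longrightarrow> Cod C f \<in> Ob C"
    and Id_in: "X \<in> Ob C \<Longrightarrow> Id C X \<in> Arr C"
    and Dom_Id: "X \<in> Ob C \<Longrightarrow> Dom C (Id C X) = X"
    and Cod_Id: "X \<in> Ob C \<Longrightarrow> Cod C (Id C X) = X"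
    and Comp_in: "\<lbrakk>f \<in> Arr C; g \<in> Arr C; Cod C f = Dom C g\<rbrakk> \<Longrightarrow> Comp C g f \<in> Arr C"
    and Dom_Comp: "\<lbrakk>f \<in> Arr C; g \<in> Arr C; Cod C f = Dom C g\<rbrakk> \<Longrightarrow> Dom C (Comp C g f) = Dom C f"
    and Cod_Comp: "\<lbrakk>f \<in> Arr C; g \<in> Arr C; Cod C f = Dom C g\<rbrakk> \<Longrightarrow> Cod C (Comp C g f) = Cod C g"
    and Comp_Id_left: "f \<in> Arr C \<Longrightarrow> Comp C (Id C (Cod C f)) f = f"
    and Comp_Id_right: "f \<in> Arr C \<Longrightarrow> Comp C f (Id C (Dom C f)) = f"
    and Comp_assoc: "\<lbrakk>f \<in> Arr C; g \<in> Arr C; h \<in> Arr C; Cod C f = Dom C g; Cod C g = Dom C h\<rbrakk>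
      \<Longrightarrow> Comp C h (Comp C g f) = Comp C (Comp C h g) f"

definition op_cat :: "('o, 'm) cat \<Rightarrow> ('o, 'm) cat" where
  "op_cat C = \<lparr>Ob = Ob C, Arr = Arr C, Dom = Cod C, Cod = Dom C, Id = Id C,
     Comp = (\<lambda>g f. Comp C f g)\<rparr>"

record ('o1, 'm1, 'o2, 'm2) cfunctor =
  Source :: "('o1, 'm1) cat"
  Target :: "('o2, 'm2) cat"
  obj_map :: "'o1 \<Rightarrow> 'o2"
  arr_map :: "'m1 \<Rightarrow> 'm2"

text \<open>The two maps of a functor are extensional (\<open>undefined\<close> off the source category), so that
  equality of \<open>cfunctor\<close> records is strict equality of functors.\<close>

locale is_functor = source: category C + target: category D
  for C :: "('o1, 'm1) cat" and D :: "('o2, 'm2) cat" +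
  fixes F :: "('o1, 'm1, 'o2, 'm2) cfunctor"
  assumes Source_eq: "Source F = C"
    and Target_eq: "Target F = D"
    and obj_map_in: "obj_map F \<in> Ob C \<rightarrow>\<^sub>E Ob D"
    and arr_map_in: "arr_map F \<in> Arr C \<rightarrow>\<^sub>E Arr D"
    and map_Dom: "f \<in> Arr C \<Longrightarrow> Dom D (arr_map F f) = obj_map F (Dom C f)"
    and map_Cod: "f \<in> Arr C \<Longrightarrow> Cod D (arr_map F f) = obj_map F (Cod C f)"
    and map_Id: "X \<in> Ob C \<Longrightarrow> arr_map F (Id C X) = Id D (obj_map F X)"
    and map_Comp: "\<lbrakk>f \<in> Arr C; g \<in> Arr C; Cod C f = Dom C g\<rbrakk>
      \<Longrightarrow> arr_map F (Comp C g f) = Comp D (arr_map F g) (arr_map F f)"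

definition id_functor :: "('o, 'm) cat \<Rightarrow> ('o, 'm, 'o, 'm) cfunctor" where
  "id_functor C = \<lparr>Source = C, Target = C,
     obj_map = (\<lambda>X\<in>Ob C. X), arr_map = (\<lambda>f\<in>Arr C. f)\<rparr>"

definition comp_functor ::
  "('o2, 'm2, 'o3, 'm3) cfunctor \<Rightarrow> ('o1, 'm1, 'o2, 'm2) cfunctor \<Rightarrow> ('o1, 'm1, 'o3, 'm3) cfunctor"
  (infixr "\<circ>\<^sub>F" 55) where
  "G \<circ>\<^sub>F F = \<lparr>Source = Source F, Target = Target G,
     obj_map = compose (Ob (Source F)) (obj_map G) (obj_map F),
     arr_map = compose (Arr (Source F)) (arr_map G) (arr_map F)\<rparr>"

definition op_functor ::
  "('o1, 'm1, 'o2, 'm2) cfunctor \<Rightarrow> ('o1, 'm1, 'o2, 'm2) cfunctor" where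
  "op_functor F = \<lparr>Source = op_cat (Source F), Target = op_cat (Target F),
     obj_map = obj_map F, arr_map = arr_map F\<rparr>"

definition iso_of_categories ::
  "('o1, 'm1) cat \<Rightarrow> ('o2, 'm2) cat \<Rightarrow>
   ('o1, 'm1, 'o2, 'm2) cfunctor \<Rightarrow> ('o2, 'm2, 'o1, 'm1) cfunctor \<Rightarrow> bool" where
  "iso_of_categories C D F G \<longleftrightarrow>
     is_functor C D F \<and> is_functor D C G \<and> G \<circ>\<^sub>F F = id_functor C \<and> F \<circ>\<^sub>F G = id_functor D"

section \<open>Categories of structured sets\<close>

text \<open>An arrow carries its source and target; its underlying function is extensional on the
  underlying set of the source. The objects of each category below have their underlying sets in
  a type \<open>'a\<close> (in \<open>'a set\<close> for the posets); \<open>'a\<close> is arbitrary and plays the role of the universe.\<close>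

datatype ('o, 'a) mor = Mor (src: 'o) (fn: "'a \<Rightarrow> 'a") (tgt: 'o)

definition structured_cat ::
  "'o set \<Rightarrow> ('o \<Rightarrow> 'a set) \<Rightarrow> ('o \<Rightarrow> 'o \<Rightarrow> ('a \<Rightarrow> 'a) \<Rightarrow> bool) \<Rightarrow> ('o, ('o, 'a) mor) cat" where
  "structured_cat obs U hom = \<lparr>
     Ob = obs,
     Arr = {Mor A f B | A f B. A \<in> obs \<and> B \<in> obs \<and> f \<in> U A \<rightarrow>\<^sub>E U B \<and> hom A B f},
     Dom = src,
     Cod = tgt,
     Id = (\<lambda>A. Mor A (\<lambda>x\<in>U A. x) A),
     Comp = (\<lambda>g f. Mor (src f) (compose (U (src f)) (fn g) (fn f)) (tgt g))\<rparr>"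

section \<open>Finite posets\<close>

record 'b poset =
  carr :: "'b set"
  ord :: "('b \<times> 'b) set"

definition finite_poset :: "'b poset \<Rightarrow> bool" where
  "finite_poset P \<longleftrightarrow> finite (carr P) \<and> partial_order_on (carr P) (ord P)"

definition order_preserving :: "'b poset \<Rightarrow> 'b poset \<Rightarrow> ('b \<Rightarrow> 'b) \<Rightarrow> bool" where
  "order_preserving P Q f \<longleftrightarrow> (\<forall>x y. (x, y) \<in> ord P \<longrightarrow> (f x, f y) \<in> ord Q)"

definition FinPos :: "('b poset, ('b poset, 'b) mor) cat" where
  "FinPos = structured_cat {P. finite_poset P} carr order_preserving"

definition incl_poset :: "'a set set \<Rightarrow> 'a set poset" where
  "incl_poset R = \<lparr>carr = R, ord = relation_of (\<subseteq>) R\<rparr>"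

section \<open>PreDSCs\<close>

record 'a predsc =
  pts :: "'a set"
  dep :: "'a \<Rightarrow> 'a set set"

definition is_predsc :: "'a predsc \<Rightarrow> bool" where
  "is_predsc A \<longleftrightarrow> finite (pts A) \<and> dep A \<in> pts A \<rightarrow>\<^sub>E Pow (Pow (pts A))"

definition irredundant :: "'a predsc \<Rightarrow> bool" where
  "irredundant A \<longleftrightarrow> (\<forall>e\<in>pts A. \<forall>D0\<in>dep A e. \<forall>D1\<in>dep A e. D0 \<subseteq> D1 \<longrightarrow> D0 = D1)"

definition rch :: "'a predsc \<Rightarrow> 'a set \<Rightarrow> 'a set \<Rightarrow> bool" where
  "rch A X Y \<longleftrightarrow> X \<subseteq> Y \<and> Y \<subseteq> pts A \<and> (\<forall>y\<in>Y. \<exists>D\<in>dep A y. D \<subseteq> X)"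

definition reachable :: "'a predsc \<Rightarrow> 'a set \<Rightarrow> bool" where
  "reachable A X \<longleftrightarrow> X \<subseteq> pts A \<and>
     (\<exists>Xs. Xs \<noteq> [] \<and> successively (rch A) ({} # Xs @ [X]))"

definition predsc_hom :: "'a predsc \<Rightarrow> 'a predsc \<Rightarrow> ('a \<Rightarrow> 'a) \<Rightarrow> bool" where
  "predsc_hom A B f \<longleftrightarrow> (\<forall>X. reachable B X \<longrightarrow> reachable A (f -` X \<inter> pts A))"

definition iPreDSC :: "('a predsc, ('a predsc, 'a) mor) cat" where
  "iPreDSC = structured_cat {A. is_predsc A \<and> irredundant A} pts predsc_hom"

definition rdp_obj :: "'a predsc \<Rightarrow> 'a set poset" where
  "rdp_obj A = incl_poset {X. reachable A X}"

definition rdp ::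
  "('a predsc, ('a predsc, 'a) mor, 'a set poset, ('a set poset, 'a set) mor) cfunctor" where
  "rdp = \<lparr>Source = op_cat iPreDSC, Target = FinPos,
     obj_map = (\<lambda>A\<in>Ob iPreDSC. rdp_obj A),
     arr_map = (\<lambda>m\<in>Arr iPreDSC. Mor (rdp_obj (tgt m))
       (\<lambda>X\<in>{X. reachable (tgt m) X}. fn m -` X \<inter> pts (src m)) (rdp_obj (src m)))\<rparr>"

section \<open>Conflict-free event structures\<close>

record 'a cfes =
  events :: "'a set"
  en :: "'a \<Rightarrow> 'a set set"

definition is_cfes :: "'a cfes \<Rightarrow> bool" where
  "is_cfes A \<longleftrightarrow> finite (events A) \<and> en A \<in> events A \<rightarrow>\<^sub>E Pow (Pow (events A)) \<and>
     (\<forall>e\<in>events A. \<forall>X Y. X \<in> en A e \<and> X \<subseteq> Y \<and> Y \<subseteq> events A \<longrightarrow> Y \<in> en A e)"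

definition configuration :: "'a cfes \<Rightarrow> 'a set \<Rightarrow> bool" where
  "configuration A X \<longleftrightarrow> X \<subseteq> events A \<and>
     (\<forall>e\<in>X. \<exists>es. es \<noteq> [] \<and> set es \<subseteq> X \<and> last es = e \<and>
        (\<forall>i<length es. set (take i es) \<in> en A (es ! i)))"

definition cfes_hom :: "'a cfes \<Rightarrow> 'a cfes \<Rightarrow> ('a \<Rightarrow> 'a) \<Rightarrow> bool" where
  "cfes_hom A B f \<longleftrightarrow> (\<forall>X. configuration B X \<longrightarrow> configuration A (f -` X \<inter> events A))"

definition CFES :: "('a cfes, ('a cfes, 'a) mor) cat" where
  "CFES = structured_cat {A. is_cfes A} events cfes_hom"

definition conf_obj :: "'a cfes \<Rightarrow> 'a set poset" where
  "conf_obj A = incl_poset {X. configuration A X}"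

definition conf ::
  "('a cfes, ('a cfes, 'a) mor, 'a set poset, ('a set poset, 'a set) mor) cfunctor" where
  "conf = \<lparr>Source = op_cat CFES, Target = FinPos,
     obj_map = (\<lambda>A\<in>Ob CFES. conf_obj A),
     arr_map = (\<lambda>m\<in>Arr CFES. Mor (conf_obj (tgt m))
       (\<lambda>X\<in>{X. configuration (tgt m) X}. fn m -` X \<inter> events (src m)) (conf_obj (src m)))\<rparr>"

section \<open>The functors between them\<close>

definition en0 :: "'a cfes \<Rightarrow> 'a \<Rightarrow> 'a set set" where
  "en0 A e = {X. X \<in> en A e \<and> (\<forall>Y. Y \<subseteq> X \<and> Y \<in> en A e \<longrightarrow> Y = X)}"

definition alpha_obj :: "'a cfes \<Rightarrow> 'a predsc" where
  "alpha_obj A = \<lparr>pts = events A, dep = (\<lambda>e\<in>events A. en0 A e)\<rparr>"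

definition alpha ::
  "('a cfes, ('a cfes, 'a) mor, 'a predsc, ('a predsc, 'a) mor) cfunctor" where
  "alpha = \<lparr>Source = CFES, Target = iPreDSC,
     obj_map = (\<lambda>A\<in>Ob CFES. alpha_obj A),
     arr_map = (\<lambda>m\<in>Arr CFES. Mor (alpha_obj (src m)) (fn m) (alpha_obj (tgt m)))\<rparr>"

definition en_dep :: "'a predsc \<Rightarrow> 'a \<Rightarrow> 'a set set" where
  "en_dep A e = {X. X \<subseteq> pts A \<and> (\<exists>Y. Y \<subseteq> X \<and> Y \<in> dep A e)}"

definition beta_obj :: "'a predsc \<Rightarrow> 'a cfes" where
  "beta_obj A = \<lparr>events = pts A, en = (\<lambda>e\<in>pts A. en_dep A e)\<rparr>"

definition beta ::
  "('a predsc, ('a predsc, 'a) mor, 'a cfes, ('a cfes, 'a) mor) cfunctor" where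
  "beta = \<lparr>Source = iPreDSC, Target = CFES,
     obj_map = (\<lambda>A\<in>Ob iPreDSC. beta_obj A),
     arr_map = (\<lambda>m\<in>Arr iPreDSC. Mor (beta_obj (src m)) (fn m) (beta_obj (tgt m)))\<rparr>"

end

theory Submission
  imports Defs
begin

text \<open>
  Everything reduces to one combinatorial fact, \<open>configuration_beta_obj_iff_reachable\<close>: on a finite
  set, saturating in parallel (\<open>rch\<close>-chains of subsets) and saturating one event at a time
  (enabled lists of events) generate the same subsets. A chain of subsets becomes a list by
  adding the events of each step one after the other; a list becomes a chain by taking the
  sets of its prefixes. The translation needs that enablings are closed under supersets, so that
  events may be added earlier than required and whole lists may be concatenated.

  On objects, \<open>alpha_obj\<close> and \<open>beta_obj\<close> are inverse to each other because an upward closed family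
  of subsets of a finite set is the same thing as the antichain of its minimal members. With this,
  the combinatorial fact for \<open>beta_obj\<close> transfers to \<open>alpha_obj\<close>.

  What remains is formal. In both categories the morphisms are the functions under which preimages
  of distinguished subsets (configurations, reachable subsets) are distinguished, and both
  functors to finite posets send an object to its distinguished subsets. Morphisms and functor
  depend on an object only through its underlying set and its distinguished subsets, so any
  bijection of objects that preserves these two is an isomorphism of categories that commutes
  strictly with the functors (\<open>relabel_functor_comp_eq_id_functor\<close>,
  \<open>subsets_functor_comp_relabel_functor\<close>).
\<close>

section \<open>Categories of sets with distinguished subsets\<close>

text \<open>Here \<open>U\<close> stands for \<open>events\<close> or \<open>pts\<close>, and \<open>R A X\<close> for \<open>configuration A X\<close> or
  \<open>reachable A X\<close>.\<close>

definition preimage_hom :: "('o \<Rightarrow> 'a set) \<Rightarrow> ('o \<Rightarrow> 'a set \<Rightarrow> bool) \<Rightarrow> 'o \<Rightarrow> 'o \<Rightarrow> ('a \<Rightarrow> 'a) \<Rightarrow> bool"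
  where "preimage_hom U R A B f \<longleftrightarrow> (\<forall>X. R B X \<longrightarrow> R A (f -` X \<inter> U A))"

abbreviation preimage_cat ::
  "'o set \<Rightarrow> ('o \<Rightarrow> 'a set) \<Rightarrow> ('o \<Rightarrow> 'a set \<Rightarrow> bool) \<Rightarrow> ('o, ('o, 'a) mor) cat"
  where "preimage_cat obs U R \<equiv> structured_cat obs U (preimage_hom U R)"

definition subsets_functor ::
  "'o set \<Rightarrow> ('o \<Rightarrow> 'a set) \<Rightarrow> ('o \<Rightarrow> 'a set \<Rightarrow> bool) \<Rightarrow>
   ('o, ('o, 'a) mor, 'a set poset, ('a set poset, 'a set) mor) cfunctor"
  where "subsets_functor obs U R = \<lparr>Source = op_cat (preimage_cat obs U R), Target = FinPos,
     obj_map = (\<lambda>A\<in>obs. incl_poset {X. R A X}),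
     arr_map = (\<lambda>m\<in>Arr (preimage_cat obs U R). Mor (incl_poset {X. R (tgt m) X})
       (\<lambda>X\<in>{X. R (tgt m) X}. fn m -` X \<inter> U (src m)) (incl_poset {X. R (src m) X}))\<rparr>"

lemma structured_cat_simps [simp]:
  "Ob (structured_cat obs U hom) = obs"
  "Dom (structured_cat obs U hom) = src"
  "Cod (structured_cat obs U hom) = tgt"
  "Id (structured_cat obs U hom) = (\<lambda>A. Mor A (\<lambda>x\<in>U A. x) A)"
  "Comp (structured_cat obs U hom) =
    (\<lambda>g f. Mor (src f) (compose (U (src f)) (fn g) (fn f)) (tgt g))"
  by (simp_all add: structured_cat_def)

lemma in_Arr_structured_cat_iff:
  "m \<in> Arr (structured_cat obs U hom) \<longleftrightarrow> src m \<in> obs \<and> tgt m \<in> obs \<and>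
    fn m \<in> U (src m) \<rightarrow>\<^sub>E U (tgt m) \<and> hom (src m) (tgt m) (fn m)"
  by (cases m) (auto simp: structured_cat_def)

lemma op_cat_simps [simp]:
  "Ob (op_cat C) = Ob C" "Arr (op_cat C) = Arr C" "Dom (op_cat C) = Cod C" "Cod (op_cat C) = Dom C"
  "Id (op_cat C) = Id C" "Comp (op_cat C) = (\<lambda>g f. Comp C f g)"
  by (simp_all add: op_cat_def)

lemma category_op_cat: "category C \<Longrightarrow> category (op_cat C)"
  by (simp add: category_def)

lemma category_structured_cat:
  assumes ident: "\<And>A. A \<in> obs \<Longrightarrow> hom A A (\<lambda>x\<in>U A. x)"
    and comp: "\<And>A B C f g. \<lbrakk>A \<in> obs; B \<in> obs; C \<in> obs; f \<in> U A \<rightarrow>\<^sub>E U B; g \<in> U B \<rightarrow>\<^sub>E U C;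
      hom A B f; hom B C g\<rbrakk> \<Longrightarrow> hom A C (compose (U A) g f)"
  shows "category (structured_cat obs U hom)" (is "category ?C")
proof
  fix f g
  assume "f \<in> Arr ?C" "g \<in> Arr ?C" "Cod ?C f = Dom ?C g"
  then show "Comp ?C g f \<in> Arr ?C"
    using comp[of "src f" "tgt f" "tgt g" "fn f" "fn g"]
    by (auto simp: in_Arr_structured_cat_iff PiE_iff compose_def)
next
  fix f g h
  assume "f \<in> Arr ?C" "Cod ?C f = Dom ?C g"
  then have "fn f \<in> U (src f) \<rightarrow> U (src g)"
    by (auto simp: in_Arr_structured_cat_iff)
  then show "Comp ?C h (Comp ?C g f) = Comp ?C (Comp ?C h g) f"
    by (simp add: compose_assoc)
next
  fix f
  assume "f \<in> Arr ?C"
  then have "fn f \<in> U (src f) \<rightarrow> U (tgt f)" "fn f \<in> extensional (U (src f))"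
    by (auto simp: in_Arr_structured_cat_iff PiE_iff)
  then show "Comp ?C (Id ?C (Cod ?C f)) f = f" "Comp ?C f (Id ?C (Dom ?C f)) = f"
    by (simp_all add: Id_compose compose_Id)
qed (use ident in \<open>simp_all add: in_Arr_structured_cat_iff\<close>)

text \<open>The preimage under the identity of \<open>A\<close> cuts a set down to \<open>U A\<close>; the identity is a morphism
  because distinguished subsets lie in \<open>U A\<close> and are left unchanged.\<close>

lemma category_preimage_cat:
  assumes sub: "\<And>A X. A \<in> obs \<Longrightarrow> R A X \<Longrightarrow> X \<subseteq> U A"
  shows "category (preimage_cat obs U R)"
proof (rule category_structured_cat)
  fix A assume "A \<in> obs"
  have "(\<lambda>x\<in>U A. x) -` X \<inter> U A = X \<inter> U A" for X by auto
  then show "preimage_hom U R A A (\<lambda>x\<in>U A. x)"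
    using sub[OF \<open>A \<in> obs\<close>] by (auto simp: preimage_hom_def Int_absorb2)
next
  fix A B C f g
  assume "f \<in> U A \<rightarrow>\<^sub>E U B" "preimage_hom U R A B f" "preimage_hom U R B C g"
  moreover from this have "compose (U A) g f -` X \<inter> U A = f -` (g -` X \<inter> U B) \<inter> U A" for X
    by (auto simp: compose_def)
  ultimately show "preimage_hom U R A C (compose (U A) g f)"
    by (simp add: preimage_hom_def del: vimage_Int)
qed

lemma category_FinPos: "category FinPos"
  unfolding FinPos_def
proof (rule category_structured_cat)
  fix P :: "'b poset" assume "P \<in> {P. finite_poset P}"
  then have "ord P \<subseteq> carr P \<times> carr P"
    by (auto simp: finite_poset_def partial_order_on_def preorder_on_def refl_on_def)
  then show "order_preserving P P (\<lambda>x\<in>carr P. x)"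
    by (auto simp: order_preserving_def)
next
  fix P Q S :: "'b poset" and f g :: "'b \<Rightarrow> 'b"
  assume "P \<in> {P. finite_poset P}" "order_preserving P Q f" "order_preserving Q S g"
  moreover from this have "ord P \<subseteq> carr P \<times> carr P"
    by (auto simp: finite_poset_def partial_order_on_def preorder_on_def refl_on_def)
  ultimately show "order_preserving P S (compose (carr P) g f)"
    by (auto simp: order_preserving_def compose_def)
qed

lemma carr_incl_poset [simp]: "carr (incl_poset \<R>) = \<R>"
  by (simp add: incl_poset_def)

lemma finite_poset_incl_poset: "finite \<R> \<Longrightarrow> finite_poset (incl_poset \<R>)"
  by (auto simp: finite_poset_def incl_poset_def intro!: partial_order_on_relation_ofI)

lemma is_functor_subsets_functor:
  assumes fin: "\<And>A. A \<in> obs \<Longrightarrow> finite (U A)"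
    and sub: "\<And>A X. A \<in> obs \<Longrightarrow> R A X \<Longrightarrow> X \<subseteq> U A"
  shows "is_functor (op_cat (preimage_cat obs U R)) FinPos (subsets_functor obs U R)"
proof -
  let ?C = "preimage_cat obs U R" and ?F = "subsets_functor obs U R"
  have finpos: "finite_poset (incl_poset {X. R A X})" if "A \<in> obs" for A
    by (rule finite_poset_incl_poset, rule finite_subset[of _ "Pow (U A)"])
      (use that fin sub in auto)
  interpret C: category ?C
    by (intro category_preimage_cat sub)
  interpret source: category "op_cat ?C"
    by (intro category_op_cat category_preimage_cat sub)
  interpret target: category FinPos
    by (rule category_FinPos)
  show ?thesis
  proof
    have "Mor (incl_poset {X. R (tgt m) X}) (\<lambda>X\<in>{X. R (tgt m) X}. fn m -` X \<inter> U (src m))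
      (incl_poset {X. R (src m) X}) \<in> Arr FinPos" if "m \<in> Arr ?C" for m
    proof -
      have "order_preserving (incl_poset {X. R (tgt m) X}) (incl_poset {X. R (src m) X})
        (\<lambda>X\<in>{X. R (tgt m) X}. fn m -` X \<inter> U (src m))"
        using that by (auto simp: in_Arr_structured_cat_iff order_preserving_def incl_poset_def
            relation_of_def preimage_hom_def)
      with that finpos show ?thesis
        by (auto simp: FinPos_def in_Arr_structured_cat_iff preimage_hom_def)
    qed
    then show "arr_map ?F \<in> Arr (op_cat ?C) \<rightarrow>\<^sub>E Arr FinPos"
      by (auto simp: subsets_functor_def)
  next
    fix A assume "A \<in> Ob (op_cat ?C)"
    then have "A \<in> obs" and "Id ?C A \<in> Arr ?C"
      using C.Id_in by simp_all
    moreover have "(\<lambda>x\<in>U A. x) -` X \<inter> U A = X" if "R A X" for X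
      using sub[OF \<open>A \<in> obs\<close> that] by auto
    ultimately show "arr_map ?F (Id (op_cat ?C) A) = Id FinPos (obj_map ?F A)"
      by (auto simp: subsets_functor_def FinPos_def intro!: restrict_ext)
  next
    fix f g
    assume f: "f \<in> Arr (op_cat ?C)" and g: "g \<in> Arr (op_cat ?C)"
      and eq: "Cod (op_cat ?C) f = Dom (op_cat ?C) g"
    then have "Comp ?C f g \<in> Arr ?C"
      using C.Comp_in by simp
    moreover have "compose (U (src g)) (fn f) (fn g) -` X \<inter> U (src g) =
      fn g -` (fn f -` X \<inter> U (src f)) \<inter> U (src g)" for X
      using g eq by (auto simp: compose_def in_Arr_structured_cat_iff)
    moreover have "R (src f) (fn f -` X \<inter> U (src f))" if "R (tgt f) X" for X
      using f that by (auto simp: in_Arr_structured_cat_iff preimage_hom_def)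
    ultimately show "arr_map ?F (Comp (op_cat ?C) g f) = Comp FinPos (arr_map ?F g) (arr_map ?F f)"
      using f g eq
      by (auto simp: subsets_functor_def FinPos_def compose_def intro!: restrict_ext)
  qed (use finpos in \<open>auto simp: subsets_functor_def FinPos_def in_Arr_structured_cat_iff\<close>)
qed

section \<open>Changing the presentation of the objects\<close>

text \<open>The common shape of \<open>alpha\<close> and \<open>beta\<close>: the functions under the morphisms do not change.\<close>

definition relabel_functor ::
  "('o1, ('o1, 'a) mor) cat \<Rightarrow> ('o2, ('o2, 'a) mor) cat \<Rightarrow> ('o1 \<Rightarrow> 'o2) \<Rightarrow>
   ('o1, ('o1, 'a) mor, 'o2, ('o2, 'a) mor) cfunctor"
  where "relabel_functor C D \<phi> = \<lparr>Source = C, Target = D, obj_map = (\<lambda>A\<in>Ob C. \<phi> A),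
     arr_map = (\<lambda>m\<in>Arr C. Mor (\<phi> (src m)) (fn m) (\<phi> (tgt m)))\<rparr>"

lemma relabel_in_Arr:
  assumes "m \<in> Arr (preimage_cat obs U R)"
    and "\<And>A. A \<in> obs \<Longrightarrow> \<phi> A \<in> obs'" "\<And>A. A \<in> obs \<Longrightarrow> U' (\<phi> A) = U A"
    and "\<And>A X. A \<in> obs \<Longrightarrow> R' (\<phi> A) X = R A X"
  shows "Mor (\<phi> (src m)) (fn m) (\<phi> (tgt m)) \<in> Arr (preimage_cat obs' U' R')"
  using assms by (auto simp: in_Arr_structured_cat_iff preimage_hom_def)

lemma is_functor_relabel_functor:
  assumes "\<And>A X. A \<in> obs \<Longrightarrow> R A X \<Longrightarrow> X \<subseteq> U A" "\<And>A X. A \<in> obs' \<Longrightarrow> R' A X \<Longrightarrow> X \<subseteq> U' A"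
    and \<phi>: "\<And>A. A \<in> obs \<Longrightarrow> \<phi> A \<in> obs'" "\<And>A. A \<in> obs \<Longrightarrow> U' (\<phi> A) = U A"
      "\<And>A X. A \<in> obs \<Longrightarrow> R' (\<phi> A) X = R A X"
  shows "is_functor (preimage_cat obs U R) (preimage_cat obs' U' R')
    (relabel_functor (preimage_cat obs U R) (preimage_cat obs' U' R') \<phi>)"
proof -
  let ?C = "preimage_cat obs U R" and ?D = "preimage_cat obs' U' R'"
  let ?F = "relabel_functor ?C ?D \<phi>"
  interpret source: category ?C by (intro category_preimage_cat assms)
  interpret target: category ?D by (intro category_preimage_cat assms)
  show ?thesis
  proof
    show "arr_map ?F \<in> Arr ?C \<rightarrow>\<^sub>E Arr ?D"
      using relabel_in_Arr[of _ obs U R \<phi> obs' U' R', OF _ \<phi>] by (auto simp: relabel_functor_def)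
  next
    fix A assume "A \<in> Ob ?C"
    with source.Id_in[OF this] \<phi> show "arr_map ?F (Id ?C A) = Id ?D (obj_map ?F A)"
      by (simp add: relabel_functor_def)
  next
    fix f g assume "f \<in> Arr ?C" "g \<in> Arr ?C" "Cod ?C f = Dom ?C g"
    moreover from source.Comp_in[OF this] have "Comp ?C g f \<in> Arr ?C" .
    moreover from calculation have "src f \<in> obs"
      by (simp add: in_Arr_structured_cat_iff)
    ultimately show "arr_map ?F (Comp ?C g f) = Comp ?D (arr_map ?F g) (arr_map ?F f)"
      using \<phi> by (simp add: relabel_functor_def)
  qed (use \<phi> in \<open>auto simp: relabel_functor_def in_Arr_structured_cat_iff\<close>)
qed

lemma relabel_functor_comp_eq_id_functor:
  assumes \<phi>: "\<And>A. A \<in> obs \<Longrightarrow> \<phi> A \<in> obs'" "\<And>A. A \<in> obs \<Longrightarrow> U' (\<phi> A) = U A"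
      "\<And>A X. A \<in> obs \<Longrightarrow> R' (\<phi> A) X = R A X"
    and \<psi>: "\<And>A. A \<in> obs \<Longrightarrow> \<psi> (\<phi> A) = A"
  shows "relabel_functor (preimage_cat obs' U' R') (preimage_cat obs U R) \<psi> \<circ>\<^sub>F
    relabel_functor (preimage_cat obs U R) (preimage_cat obs' U' R') \<phi> =
    id_functor (preimage_cat obs U R)"
proof -
  have "src m \<in> obs" "tgt m \<in> obs" if "m \<in> Arr (preimage_cat obs U R)" for m
    using that by (simp_all add: in_Arr_structured_cat_iff)
  then show ?thesis
    using \<phi>(1) \<psi> relabel_in_Arr[of _ obs U R \<phi> obs' U' R', OF _ \<phi>]
    by (simp add: relabel_functor_def comp_functor_def id_functor_def compose_def
        cong: restrict_cong)
qed

lemma subsets_functor_comp_relabel_functor: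
  assumes \<phi>: "\<And>A. A \<in> obs \<Longrightarrow> \<phi> A \<in> obs'" "\<And>A. A \<in> obs \<Longrightarrow> U' (\<phi> A) = U A"
      "\<And>A X. A \<in> obs \<Longrightarrow> R' (\<phi> A) X = R A X"
  shows "subsets_functor obs' U' R' \<circ>\<^sub>F
    op_functor (relabel_functor (preimage_cat obs U R) (preimage_cat obs' U' R') \<phi>) =
    subsets_functor obs U R"
proof -
  have "src m \<in> obs" "tgt m \<in> obs" if "m \<in> Arr (preimage_cat obs U R)" for m
    using that by (simp_all add: in_Arr_structured_cat_iff)
  moreover have "R' (\<phi> A) = R A" if "A \<in> obs" for A
    using \<phi>(3)[OF that] by blast
  ultimately show ?thesis
    using \<phi>(1,2) relabel_in_Arr[of _ obs U R \<phi> obs' U' R', OF _ \<phi>]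
    by (simp add: relabel_functor_def comp_functor_def subsets_functor_def op_functor_def
        compose_def cong: restrict_cong)
qed

section \<open>Configurations and reachable subsets\<close>

text \<open>A chain witnessing reachability has at least two steps, but this is no restriction because
  chains from the empty set may be padded with \<open>rch A {} {}\<close> at the front.\<close>

lemma reachable_iff_rtranclp: "reachable A X \<longleftrightarrow> (rch A)\<^sup>*\<^sup>* {} X"
proof
  have "(rch A)\<^sup>*\<^sup>* Y X" if "successively (rch A) (Y # Xs @ [X])" for Y Xs
    using that by (induction Xs arbitrary: Y) (auto intro: converse_rtranclp_into_rtranclp)
  then show "reachable A X \<Longrightarrow> (rch A)\<^sup>*\<^sup>* {} X"
    unfolding reachable_def by blast
next
  have empty: "rch A {} {}"
    by (simp add: rch_def)
  assume "(rch A)\<^sup>*\<^sup>* {} X"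
  then show "reachable A X"
  proof induction
    case base
    show ?case
      unfolding reachable_def using empty by (auto intro!: exI[of _ "[{}]"])
  next
    case (step Y Z)
    then obtain Xs where "successively (rch A) ({} # Xs @ [Y])"
      by (auto simp: reachable_def)
    then have "successively (rch A) (({} # Xs @ [Y]) @ [Z])"
      unfolding successively_append_iff using step by simp
    moreover have "Z \<subseteq> pts A"
      using step by (simp add: rch_def)
    ultimately show ?case
      unfolding reachable_def by (intro conjI exI[of _ "Xs @ [Y]"]) auto
  qed
qed

text \<open>An event may recur, as in the definition of configurations; so lists can be concatenated
  without removing duplicates.\<close>

definition enabled_list :: "'a cfes \<Rightarrow> 'a list \<Rightarrow> bool" where
  "enabled_list A es \<longleftrightarrow> (\<forall>i<length es. set (take i es) \<in> en A (es ! i))"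

lemma enabled_list_Nil [simp]: "enabled_list A []"
  by (simp add: enabled_list_def)

lemma enabled_list_snoc [simp]:
  "enabled_list A (es @ [e]) \<longleftrightarrow> enabled_list A es \<and> set es \<in> en A e"
  by (auto simp: enabled_list_def nth_append less_Suc_eq)

lemma enabled_list_append:
  assumes A: "is_cfes A" and "set xs \<subseteq> events A" "set ys \<subseteq> events A"
    and "enabled_list A xs" "enabled_list A ys"
  shows "enabled_list A (xs @ ys)"
  using assms(3,5)
proof (induction ys rule: rev_induct)
  case (snoc y ys)
  then have "set ys \<in> en A y" "y \<in> events A" "set ys \<subseteq> events A"
    by simp_all
  then have "set (xs @ ys) \<in> en A y"
    using A assms(2) unfolding is_cfes_def
    by (metis Un_least Un_upper2 set_append)
  with snoc show ?case
    by (simp flip: append_assoc)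
qed (use assms in simp)

text \<open>The separate lists for the events of a configuration can be concatenated to a single one,
  because an enabled list stays enabled when other events happen before it.\<close>

lemma configuration_iff_enabled_list:
  assumes A: "is_cfes A"
  shows "configuration A X \<longleftrightarrow> X \<subseteq> events A \<and> (\<exists>es. set es = X \<and> enabled_list A es)"
proof
  assume conf: "configuration A X"
  then have X: "X \<subseteq> events A" and "finite X"
    using A finite_subset by (auto simp: configuration_def is_cfes_def)
  have "\<exists>es. Y \<subseteq> set es \<and> set es \<subseteq> X \<and> enabled_list A es" if "Y \<subseteq> X" for Y
    using finite_subset[OF that \<open>finite X\<close>] that
  proof (induction Y rule: finite_induct)
    case empty
    show ?case by (intro exI[of _ "[]"]) simp
  next
    case (insert y Y)
    then obtain es where es: "Y \<subseteq> set es" "set es \<subseteq> X" "enabled_list A es"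
      by auto
    obtain fs where fs: "fs \<noteq> []" "set fs \<subseteq> X" "last fs = y" "enabled_list A fs"
      using conf insert.prems by (auto simp: configuration_def enabled_list_def)
    then have "y \<in> set fs" by auto
    with es fs X enabled_list_append[OF A, of es fs] show ?case
      by (intro exI[of _ "es @ fs"]) auto
  qed
  from this[of X] X show "X \<subseteq> events A \<and> (\<exists>es. set es = X \<and> enabled_list A es)"
    by auto
next
  assume "X \<subseteq> events A \<and> (\<exists>es. set es = X \<and> enabled_list A es)"
  then obtain es where X: "X \<subseteq> events A" and es: "set es = X" "enabled_list A es"
    by blast
  show "configuration A X"
    unfolding configuration_def
  proof (intro conjI X ballI)
    fix e assume "e \<in> X"
    then obtain i where i: "i < length es" "e = es ! i"
      using es(1) by (auto simp: in_set_conv_nth)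
    \<comment> \<open>The initial segment that ends with \<open>e\<close>.\<close>
    have "last (take (Suc i) es) = e"
      using i by (simp add: take_Suc_conv_app_nth)
    moreover have "set (take (Suc i) es) \<subseteq> X"
      using es(1) set_take_subset by fast
    ultimately show "\<exists>es. es \<noteq> [] \<and> set es \<subseteq> X \<and> last es = e \<and>
        (\<forall>i<length es. set (take i es) \<in> en A (es ! i))"
      using i es(2) by (intro exI[of _ "take (Suc i) es"]) (auto simp: enabled_list_def min_def)
  qed
qed

lemma is_cfes_beta_obj:
  assumes "is_predsc B"
  shows "is_cfes (beta_obj B)"
proof -
  have "Y \<in> en_dep B e" if "X \<in> en_dep B e" "X \<subseteq> Y" "Y \<subseteq> pts B" for e X Y
    using that order_trans[OF _ \<open>X \<subseteq> Y\<close>] unfolding en_dep_def by blast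
  moreover have "en_dep B e \<subseteq> Pow (pts B)" for e
    by (auto simp: en_dep_def)
  ultimately show ?thesis
    using assms by (simp add: is_predsc_def is_cfes_def beta_obj_def) blast
qed

text \<open>For the direction from right to left, the events of a step \<open>rch B Y Z\<close> can be appended in any
  order: each of them is already enabled by \<open>Y\<close>. Conversely, along an enabled list the sets of the
  prefixes form a chain, as an event that was enabled by a shorter prefix remains enabled.\<close>

lemma configuration_beta_obj_iff_reachable:
  assumes B: "is_predsc B"
  shows "configuration (beta_obj B) X \<longleftrightarrow> reachable B X"
proof -
  note cfes = is_cfes_beta_obj[OF B]
  have en_iff: "S \<in> en (beta_obj B) e \<longleftrightarrow> S \<subseteq> pts B \<and> (\<exists>D\<in>dep B e. D \<subseteq> S)" if "e \<in> pts B" for S e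
    using that by (auto simp: beta_obj_def en_dep_def)
  have ev: "events (beta_obj B) = pts B"
    by (simp add: beta_obj_def)
  have chain_of_list: "(rch B)\<^sup>*\<^sup>* {} (set es) \<and> (\<forall>e\<in>set es. \<exists>D\<in>dep B e. D \<subseteq> set es)"
    if "set es \<subseteq> pts B" "enabled_list (beta_obj B) es" for es
    using that
  proof (induction es rule: rev_induct)
    case (snoc e es)
    then have es: "(rch B)\<^sup>*\<^sup>* {} (set es)"
      and D: "\<forall>d\<in>set (es @ [e]). \<exists>D\<in>dep B d. D \<subseteq> set es"
      by (auto simp: en_iff)
    then have "rch B (set es) (set (es @ [e]))"
      using snoc.prems by (auto simp: rch_def)
    with es have "(rch B)\<^sup>*\<^sup>* {} (set (es @ [e]))"
      by (rule rtranclp.rtrancl_into_rtrancl)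
    moreover have "\<forall>d\<in>set (es @ [e]). \<exists>D\<in>dep B d. D \<subseteq> set (es @ [e])"
      using D by simp (meson subset_insertI2)
    ultimately show ?case ..
  qed simp
  have list_of_chain: "X \<subseteq> pts B \<and> (\<exists>es. set es = X \<and> enabled_list (beta_obj B) es)"
    if "(rch B)\<^sup>*\<^sup>* {} X"
    using that
  proof induction
    case base
    show ?case by simp
  next
    case (step Y Z)
    then obtain es where es: "set es = Y" "enabled_list (beta_obj B) es" and Y: "Y \<subseteq> Z"
      and Z: "Z \<subseteq> pts B" "\<And>z. z \<in> Z \<Longrightarrow> \<exists>D\<in>dep B z. D \<subseteq> Y"
      by (auto simp: rch_def)
    have "finite Z"
      using B Z(1) finite_subset by (auto simp: is_predsc_def)
    then obtain zs where zs: "set zs = Z"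
      using finite_list by auto
    have "enabled_list (beta_obj B) (es @ ws)" if "set ws \<subseteq> Z" for ws
      using that
    proof (induction ws rule: rev_induct)
      case (snoc w ws)
      obtain D where "D \<in> dep B w" "D \<subseteq> Y"
        using Z(2)[of w] snoc.prems by auto
      then have "set (es @ ws) \<in> en (beta_obj B) w"
        using snoc.prems Z(1) Y es(1) by (subst en_iff) auto
      with snoc show ?case
        by (simp flip: append_assoc)
    qed (use es in simp)
    from this[of zs] zs es(1) Y Z(1) show ?case
      by (intro conjI exI[of _ "es @ zs"]) auto
  qed
  show ?thesis
    unfolding configuration_iff_enabled_list[OF cfes] reachable_iff_rtranclp ev
    using chain_of_list list_of_chain by metis
qed

section \<open>Upward closed families and antichains\<close>

lemma is_predsc_alpha_obj: "is_cfes A \<Longrightarrow> is_predsc (alpha_obj A)"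
  by (auto simp: is_predsc_def is_cfes_def alpha_obj_def en0_def PiE_iff)

lemma irredundant_alpha_obj: "irredundant (alpha_obj A)"
  by (auto simp: irredundant_def alpha_obj_def en0_def)

text \<open>By finiteness every enabling contains a minimal one, so the minimal ones generate.\<close>

lemma beta_obj_alpha_obj:
  assumes "is_cfes A"
  shows "beta_obj (alpha_obj A) = A"
proof -
  have "en_dep (alpha_obj A) e = en A e" if e: "e \<in> events A" for e
  proof (intro equalityI subsetI)
    fix X assume "X \<in> en_dep (alpha_obj A) e"
    then show "X \<in> en A e"
      using assms e unfolding is_cfes_def en_dep_def alpha_obj_def en0_def by auto
  next
    fix X assume X: "X \<in> en A e"
    have sub: "\<And>Y. Y \<in> en A e \<Longrightarrow> Y \<subseteq> events A" and "finite (events A)"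
      using assms e by (auto simp: is_cfes_def PiE_iff)
    then have "finite (en A e)"
      by (auto intro: finite_subset[of _ "Pow (events A)"])
    then obtain Y where "Y \<in> en A e" "Y \<subseteq> X" "\<forall>Z\<in>en A e. Z \<subseteq> Y \<longrightarrow> Y = Z"
      using finite_has_minimal2[OF _ X] by blast
    then show "X \<in> en_dep (alpha_obj A) e"
      using e sub[OF X] by (auto simp: en_dep_def alpha_obj_def en0_def)
  qed
  moreover have "en A \<in> extensional (events A)"
    using assms by (simp add: is_cfes_def PiE_iff)
  ultimately have "en (beta_obj (alpha_obj A)) = en A"
    by (auto simp: beta_obj_def alpha_obj_def fun_eq_iff extensional_def)
  then show ?thesis
    by (simp add: beta_obj_def alpha_obj_def)
qed

lemma alpha_obj_beta_obj:
  assumes B: "is_predsc B" and irr: "irredundant B"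
  shows "alpha_obj (beta_obj B) = B"
proof -
  have "en0 (beta_obj B) e = dep B e" if e: "e \<in> pts B" for e
  proof -
    have "\<And>D. D \<in> dep B e \<Longrightarrow> D \<subseteq> pts B"
      using B e by (auto simp: is_predsc_def PiE_iff)
    moreover have "\<And>D D'. D \<in> dep B e \<Longrightarrow> D' \<in> dep B e \<Longrightarrow> D \<subseteq> D' \<Longrightarrow> D = D'"
      using irr e by (auto simp: irredundant_def)
    ultimately show ?thesis
      using e unfolding en0_def beta_obj_def en_dep_def by simp (blast+)
  qed
  moreover have "dep B \<in> extensional (pts B)"
    using B by (simp add: is_predsc_def PiE_iff)
  ultimately have "dep (alpha_obj (beta_obj B)) = dep B"
    by (auto simp: beta_obj_def alpha_obj_def fun_eq_iff extensional_def)
  then show ?thesis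
    by (simp add: beta_obj_def alpha_obj_def)
qed

lemma reachable_alpha_obj_iff_configuration:
  "is_cfes A \<Longrightarrow> reachable (alpha_obj A) X \<longleftrightarrow> configuration A X"
  using configuration_beta_obj_iff_reachable[OF is_predsc_alpha_obj, of A X] by (simp add: beta_obj_alpha_obj)

section \<open>The isomorphism\<close>

lemma cfes_hom_eq_preimage_hom: "cfes_hom = preimage_hom events configuration"
  by (intro ext) (simp add: cfes_hom_def preimage_hom_def)

lemma predsc_hom_eq_preimage_hom: "predsc_hom = preimage_hom pts reachable"
  by (intro ext) (simp add: predsc_hom_def preimage_hom_def)

lemma CFES_eq_preimage_cat: "CFES = preimage_cat {A. is_cfes A} events configuration"
  by (simp add: CFES_def cfes_hom_eq_preimage_hom)

lemma iPreDSC_eq_preimage_cat: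
  "iPreDSC = preimage_cat {A. is_predsc A \<and> irredundant A} pts reachable"
  by (simp add: iPreDSC_def predsc_hom_eq_preimage_hom)

lemma conf_eq_subsets_functor: "conf = subsets_functor {A. is_cfes A} events configuration"
  by (simp add: conf_def subsets_functor_def CFES_eq_preimage_cat conf_obj_def)

lemma rdp_eq_subsets_functor:
  "rdp = subsets_functor {A. is_predsc A \<and> irredundant A} pts reachable"
  by (simp add: rdp_def subsets_functor_def iPreDSC_eq_preimage_cat rdp_obj_def)

lemma alpha_eq_relabel_functor: "alpha = relabel_functor CFES iPreDSC alpha_obj"
  by (simp add: alpha_def relabel_functor_def)

lemma beta_eq_relabel_functor: "beta = relabel_functor iPreDSC CFES beta_obj"
  by (simp add: beta_def relabel_functor_def)

theorem proposition5p9: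
  shows "iso_of_categories (CFES :: ('a cfes, ('a cfes, 'a) mor) cat)
           (iPreDSC :: ('a predsc, ('a predsc, 'a) mor) cat) alpha beta \<and>
         is_functor (op_cat (CFES :: ('a cfes, ('a cfes, 'a) mor) cat)) FinPos conf \<and>
         is_functor (op_cat (iPreDSC :: ('a predsc, ('a predsc, 'a) mor) cat)) FinPos rdp \<and>
         rdp \<circ>\<^sub>F op_functor alpha =
           (conf :: ('a cfes, ('a cfes, 'a) mor, 'a set poset, ('a set poset, 'a set) mor) cfunctor) \<and>
         conf \<circ>\<^sub>F op_functor beta =
           (rdp :: ('a predsc, ('a predsc, 'a) mor, 'a set poset, ('a set poset, 'a set) mor) cfunctor)"
proof -
  let ?E = "{A :: 'a cfes. is_cfes A}" and ?D = "{A :: 'a predsc. is_predsc A \<and> irredundant A}"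
  have fin: "\<And>A. A \<in> ?E \<Longrightarrow> finite (events A)" "\<And>A. A \<in> ?D \<Longrightarrow> finite (pts A)"
    by (simp_all add: is_cfes_def is_predsc_def)
  have sub: "\<And>A X. A \<in> ?E \<Longrightarrow> configuration A X \<Longrightarrow> X \<subseteq> events A"
    "\<And>A X. A \<in> ?D \<Longrightarrow> reachable A X \<Longrightarrow> X \<subseteq> pts A"
    by (simp_all add: configuration_def reachable_def)
  have alpha: "\<And>A. A \<in> ?E \<Longrightarrow> alpha_obj A \<in> ?D" "\<And>A. A \<in> ?E \<Longrightarrow> pts (alpha_obj A) = events A"
    "\<And>A X. A \<in> ?E \<Longrightarrow> reachable (alpha_obj A) X = configuration A X"
    "\<And>A. A \<in> ?E \<Longrightarrow> beta_obj (alpha_obj A) = A"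
    by (simp_all add: is_predsc_alpha_obj irredundant_alpha_obj beta_obj_alpha_obj
        reachable_alpha_obj_iff_configuration) (simp add: alpha_obj_def)
  have beta: "\<And>A. A \<in> ?D \<Longrightarrow> beta_obj A \<in> ?E" "\<And>A. A \<in> ?D \<Longrightarrow> events (beta_obj A) = pts A"
    "\<And>A X. A \<in> ?D \<Longrightarrow> configuration (beta_obj A) X = reachable A X"
    "\<And>A. A \<in> ?D \<Longrightarrow> alpha_obj (beta_obj A) = A"
    by (simp_all add: is_cfes_beta_obj alpha_obj_beta_obj
        configuration_beta_obj_iff_reachable) (simp add: beta_obj_def)
  show ?thesis
    unfolding iso_of_categories_def alpha_eq_relabel_functor beta_eq_relabel_functor
      CFES_eq_preimage_cat iPreDSC_eq_preimage_cat conf_eq_subsets_functor rdp_eq_subsets_functor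
    by (intro conjI is_functor_relabel_functor relabel_functor_comp_eq_id_functor
        is_functor_subsets_functor subsets_functor_comp_relabel_functor fin sub alpha beta)
qed

end
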